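(* The Components-are-Clusters method satisfies the Richness, Standard Consistency and Fixed Point axioms, but fails the Connectivity and Pair-of-Cliques axioms.
   Context: A network is a finite simple undirected unweighted graph $N=(V,E)$. A clustering of $N$ is a partition of $V$ into nonempty sets called clusters. For $S\subseteq V$, $N[S]$ is the induced subgraph. A clustering method $M$ assigns to every network $N$ a clustering $M(N)$. The Components-are-Clusters method returns, for each network, the vertex sets of its connected components as the clusters. Axioms for a clustering method $M$: Richness: for every finite set $V$ and every partition $\Gamma$ of $V$ (including the partition $\{V\}$ and the partition into singletons) there is an edge set $E$ on $V$ with $M((V,E))=\Gamma$. Standard Consistency: for every network $N=(V,E)$ and every network $N'=(V,E')$ where $E'$ is obtained from $E$ by deleting some edges whose endpoints lie in different clusters of $M(N)$ and/or adding some edges whose two endpoints lie in the same cluster of $M(N)$, we have $M(N')=M(N)$. Connectivity: there is a non-negative, non-decreasing $f:\mathbb{R}^+\to\mathbb{R}^+$ with $f(x)\to\infty$ as $x\to\infty$ such that for every network $N$ and every cluster $c$ of $M(N)$ with $|c|\ge 2$, the minimum number of edges of $N[c]$ whose removal disconnects $N[c]$ (taken to be $0$ if $N[c]$ is disconnected) is strictly greater than $f(|c|)$. Pair-of-Cliques: a pair-of-cliques component of $N$ is a connected component of $N$ whose vertex set is $A\cup B$ with $A\cap B=\emptyset$, $|A|=|B|=n$, $A$ and $B$ each inducing a clique, and exactly one edge between $A$ and $B$; its size is $2n$. $M$ satisfies Pair-of-Cliques if there is a constant $n_0$ such that for every network $N$ and every pair-of-cliques component of $N$ of size at least $n_0$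 (with cliques $A,B$), both $A$ and $B$ are clusters of $M(N)$. Fixed Point: for every network $N$ and every nonempty subcollection $\mathcal{D}\subseteq M(N)$, $M(N[\bigcup\mathcal{D}])=\mathcal{D}$. Failing an axiom means not satisfying it. *)

theory Defs
  imports Complex_Main "HOL-Library.Disjoint_Sets" "HOL-Library.Infinite_Typeclass"
begin

text \<open>A network is a pair of a vertex set and a set of edges, an edge being the set of its
  two endpoints. Methods are functions on all such pairs; the axioms constrain them only on
  pairs satisfying \<open>network\<close>.\<close>

type_synonym 'a network = "'a set \<times> 'a set set"

abbreviation verts :: "'a network \<Rightarrow> 'a set" where
  "verts N \<equiv> fst N"

abbreviation edges :: "'a network \<Rightarrow> 'a set set" where
  "edges N \<equiv> snd N"

definition network :: "'a network \<Rightarrow> bool" where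
  "network N \<longleftrightarrow> finite (verts N) \<and> (\<forall>e\<in>edges N. e \<subseteq> verts N \<and> card e = 2)"

definition induced :: "'a network \<Rightarrow> 'a set \<Rightarrow> 'a network" where
  "induced N S = (verts N \<inter> S, {e \<in> edges N. e \<subseteq> S})"

definition reachable :: "'a network \<Rightarrow> 'a \<Rightarrow> 'a \<Rightarrow> bool" where
  "reachable N u v \<longleftrightarrow> (u, v) \<in> {(x, y). {x, y} \<in> edges N}\<^sup>*"

definition connected_network :: "'a network \<Rightarrow> bool" where
  "connected_network N \<longleftrightarrow> (\<forall>u\<in>verts N. \<forall>v\<in>verts N. reachable N u v)"

text \<open>Connected components, represented by their vertex sets.\<close>

definition components :: "'a network \<Rightarrow> 'a set set" where
  "components N = {{v \<in> verts N. reachable N u v} | u. u \<in> verts N}"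

text \<open>Only meaningful for at least two vertices, where deleting all edges disconnects. For a
  disconnected network the empty edge set qualifies, so the value is 0.\<close>

definition min_edge_cut :: "'a network \<Rightarrow> nat" where
  "min_edge_cut N =
     (LEAST k. \<exists>F. F \<subseteq> edges N \<and> card F = k \<and> \<not> connected_network (verts N, edges N - F))"

definition clique :: "'a network \<Rightarrow> 'a set \<Rightarrow> bool" where
  "clique N A \<longleftrightarrow> A \<subseteq> verts N \<and> (\<forall>u\<in>A. \<forall>v\<in>A. u \<noteq> v \<longrightarrow> {u, v} \<in> edges N)"

definition pair_of_cliques_component :: "'a network \<Rightarrow> 'a set \<Rightarrow> 'a set \<Rightarrow> nat \<Rightarrow> bool" where
  "pair_of_cliques_component N A B n \<longleftrightarrow>
     A \<union> B \<in> components N \<and> A \<inter> B = {} \<and> card A = n \<and> card B = n \<and>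
     clique N A \<and> clique N B \<and>
     card {e \<in> edges N. e \<inter> A \<noteq> {} \<and> e \<inter> B \<noteq> {}} = 1"

definition clustering_method :: "('a network \<Rightarrow> 'a set set) \<Rightarrow> bool" where
  "clustering_method M \<longleftrightarrow> (\<forall>N. network N \<longrightarrow> partition_on (verts N) (M N))"

definition components_are_clusters :: "'a network \<Rightarrow> 'a set set" where
  "components_are_clusters N = components N"

definition richness :: "('a network \<Rightarrow> 'a set set) \<Rightarrow> bool" where
  "richness M \<longleftrightarrow>
     (\<forall>V \<Gamma>. finite V \<and> partition_on V \<Gamma> \<longrightarrow> (\<exists>E. network (V, E) \<and> M (V, E) = \<Gamma>))"

definition standard_consistency :: "('a network \<Rightarrow> 'a set set) \<Rightarrow> bool" where
  "standard_consistency M \<longleftrightarrow>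
     (\<forall>V E E'. network (V, E) \<and> network (V, E') \<and>
        (\<forall>u v. {u, v} \<in> E - E' \<longrightarrow>
           (\<exists>c\<in>M (V, E). \<exists>d\<in>M (V, E). c \<noteq> d \<and> u \<in> c \<and> v \<in> d)) \<and>
        (\<forall>u v. {u, v} \<in> E' - E \<longrightarrow> (\<exists>c\<in>M (V, E). u \<in> c \<and> v \<in> c))
        \<longrightarrow> M (V, E') = M (V, E))"

text \<open>The bounding function is a total real function constrained on the positive reals only;
  beyond that its values do not matter.\<close>

definition connectivity :: "('a network \<Rightarrow> 'a set set) \<Rightarrow> bool" where
  "connectivity M \<longleftrightarrow>
     (\<exists>f :: real \<Rightarrow> real.
        (\<forall>x>0. f x \<ge> 0) \<and> mono_on {0<..} f \<and> filterlim f at_top at_top \<and>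
        (\<forall>N. network N \<longrightarrow>
           (\<forall>c\<in>M N. card c \<ge> 2 \<longrightarrow> real (min_edge_cut (induced N c)) > f (real (card c)))))"

definition pair_of_cliques :: "('a network \<Rightarrow> 'a set set) \<Rightarrow> bool" where
  "pair_of_cliques M \<longleftrightarrow>
     (\<exists>n\<^sub>0 :: nat. \<forall>N A B n. network N \<and> pair_of_cliques_component N A B n \<and> 2 * n \<ge> n\<^sub>0
        \<longrightarrow> A \<in> M N \<and> B \<in> M N)"

definition fixed_point :: "('a network \<Rightarrow> 'a set set) \<Rightarrow> bool" where
  "fixed_point M \<longleftrightarrow>
     (\<forall>N D. network N \<and> D \<subseteq> M N \<and> D \<noteq> {} \<longrightarrow> M (induced N (\<Union>D)) = D)"

end

theory Submission
  imports Defs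
begin

text \<open>The three positive axioms reduce to one criterion: a partition whose blocks are internally
  connected and contain every edge is the partition into components. For the two negative ones,
  a pair of cliques joined by a single edge is connected, hence one cluster, however large the
  cliques are; yet deleting that edge disconnects it.\<close>

section \<open>Reachability along edges\<close>

lemma reachable_refl [simp]: "reachable N u u"
  by (simp add: reachable_def)

lemma reachable_edge: "{u, v} \<in> edges N \<Longrightarrow> reachable N u v"
  by (auto simp: reachable_def)

lemma reachable_trans: "reachable N u v \<Longrightarrow> reachable N v w \<Longrightarrow> reachable N u w"
  unfolding reachable_def by (rule rtrancl_trans)

lemma reachable_sym: "reachable N u v \<Longrightarrow> reachable N v u"
proof -
  have "sym {(x, y). {x, y} \<in> edges N}"
    by (auto simp: sym_def insert_commute)
  then show "reachable N u v \<Longrightarrow> reachable N v u"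
    unfolding reachable_def by (meson sym_rtrancl symD)
qed

lemma reachable_mono: "reachable N u v \<Longrightarrow> edges N \<subseteq> edges N' \<Longrightarrow> reachable N' u v"
  unfolding reachable_def by (erule rtrancl_mono[THEN subsetD, rotated]) auto

text \<open>Invariant principle for paths. It keeps paths inside a block, replays paths in an
  induced subgraph, and shows that a cut separates two vertices.\<close>

lemma reachable_closed:
  assumes "reachable N u v" "u \<in> S"
    and "\<And>x y. {x, y} \<in> edges N \<Longrightarrow> x \<in> S \<Longrightarrow> y \<in> S"
  shows "v \<in> S"
  using assms(1) unfolding reachable_def
  by (induction rule: rtrancl_induct) (use assms(2,3) in auto)

section \<open>Connected components as a partition of the vertices\<close>

lemma componentE:
  assumes "c \<in> components N"
  obtains u where "u \<in> verts N" "c = {v \<in> verts N. reachable N u v}"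
  using assms unfolding components_def by blast

lemma partition_on_components: "partition_on (verts N) (components N)"
proof (rule partition_onI)
  have "v \<in> {w \<in> verts N. reachable N v w}" if "v \<in> verts N" for v
    using that by simp
  then show "\<Union> (components N) = verts N"
    unfolding components_def by blast
  show "{} \<notin> components N"
    by (rule notI, erule componentE) (use reachable_refl[of N] in blast)
  show "disjnt p q" if pq: "p \<in> components N" "q \<in> components N" "p \<noteq> q" for p q
  proof (rule ccontr)
    assume "\<not> disjnt p q"
    then obtain x where x: "x \<in> p" "x \<in> q" by (auto simp: disjnt_def)
    obtain u where p: "p = {w \<in> verts N. reachable N u w}"
      using pq(1) by (rule componentE)
    obtain v where q: "q = {w \<in> verts N. reachable N v w}"
      using pq(2) by (rule componentE)
    have "reachable N u x" "reachable N v x" using x p q by simp_all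
    then have "reachable N u w \<longleftrightarrow> reachable N v w" for w
      by (meson reachable_trans reachable_sym)
    then have "p = q" by (simp add: p q)
    with pq show False by simp
  qed
qed

lemma reachable_in_component:
  "c \<in> components N \<Longrightarrow> u \<in> c \<Longrightarrow> v \<in> c \<Longrightarrow> reachable N u v"
  by (erule componentE) (simp, meson reachable_trans reachable_sym)

lemma component_closed_edge:
  assumes "network N" "c \<in> components N" "{u, v} \<in> edges N" "u \<in> c"
  shows "v \<in> c"
proof -
  have "v \<in> verts N" using assms by (auto simp: network_def)
  moreover obtain w where "c = {x \<in> verts N. reachable N w x}"
    using assms(2) by (rule componentE)
  ultimately show ?thesis
    using assms(4) reachable_trans[OF _ reachable_edge[OF assms(3)]] by simp
qed

lemma edge_within_component:
  assumes "network N" "{u, v} \<in> edges N"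
  shows "\<exists>c\<in>components N. u \<in> c \<and> v \<in> c"
proof -
  have "u \<in> verts N" using assms by (auto simp: network_def)
  then obtain c where "c \<in> components N" "u \<in> c"
    using partition_onD1[OF partition_on_components[of N]] by auto
  then show ?thesis using component_closed_edge[OF assms(1) _ assms(2)] by blast
qed

lemma partition_on_same_block:
  "partition_on V P \<Longrightarrow> c \<in> P \<Longrightarrow> d \<in> P \<Longrightarrow> x \<in> c \<Longrightarrow> x \<in> d \<Longrightarrow> c = d"
  by (auto simp: partition_on_def disjoint_def)

text \<open>By \<open>conn\<close> each block lies inside the reachability class of any of its
  vertices. Conversely, an edge touching block \<open>c\<close> lies in some block, which meets
  \<open>c\<close> and so equals it; hence no path leaves \<open>c\<close>.\<close>

lemma components_eqI:
  assumes P: "partition_on (verts N) P"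
    and conn: "\<And>c u v. c \<in> P \<Longrightarrow> u \<in> c \<Longrightarrow> v \<in> c \<Longrightarrow> reachable N u v"
    and edge: "\<And>u v. {u, v} \<in> edges N \<Longrightarrow> \<exists>c\<in>P. u \<in> c \<and> v \<in> c"
  shows "components N = P"
proof -
  have V: "verts N = \<Union>P" using P by (rule partition_onD1)
  have block: "{v \<in> verts N. reachable N u v} = c" if c: "c \<in> P" "u \<in> c" for c u
  proof
    show "c \<subseteq> {v \<in> verts N. reachable N u v}"
      using c conn V by blast
    have "y \<in> c" if "{x, y} \<in> edges N" "x \<in> c" for x y
      using edge[OF that(1)] that(2) c(1) partition_on_same_block[OF P] by blast
    then show "{v \<in> verts N. reachable N u v} \<subseteq> c"
      using c(2) reachable_closed[of N u _ c] by blast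
  qed
  show ?thesis
  proof
    show "components N \<subseteq> P"
      using block V by (force simp: components_def)
    show "P \<subseteq> components N"
    proof
      fix c assume c: "c \<in> P"
      then obtain u where u: "u \<in> c"
        using partition_onD3[OF P] by (metis ex_in_conv)
      then have "u \<in> verts N" using c V by blast
      then show "c \<in> components N"
        unfolding components_def using block[OF c u] by blast
    qed
  qed
qed

section \<open>The satisfied axioms: Richness, Standard Consistency, Fixed Point\<close>

lemma richness_components: "richness components"
  unfolding richness_def
proof (intro allI impI)
  fix V :: "'a set" and \<Gamma>
  assume "finite V \<and> partition_on V \<Gamma>"
  then have fin: "finite V" and P: "partition_on V \<Gamma>" by auto
  \<comment> \<open>The witness is a disjoint union of complete graphs, one on each block.\<close>
  define E where "E = {e. card e = 2 \<and> (\<exists>c\<in>\<Gamma>. e \<subseteq> c)}"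
  have "network (V, E)"
    using fin partition_onD1[OF P] by (auto simp: network_def E_def)
  moreover have "components (V, E) = \<Gamma>"
  proof (rule components_eqI)
    show "partition_on (verts (V, E)) \<Gamma>" using P by simp
    show "reachable (V, E) u v" if "c \<in> \<Gamma>" "u \<in> c" "v \<in> c" for c u v
      by (cases "u = v") (use that in \<open>auto intro!: reachable_edge simp: E_def\<close>)
    show "\<exists>c\<in>\<Gamma>. u \<in> c \<and> v \<in> c" if "{u, v} \<in> edges (V, E)" for u v
      using that by (auto simp: E_def)
  qed
  ultimately show "\<exists>E. network (V, E) \<and> components (V, E) = \<Gamma>" by blast
qed

lemma standard_consistency_components: "standard_consistency components"
  unfolding standard_consistency_def
proof (intro allI impI, elim conjE)
  fix V :: "'a set" and E E'
  let ?P = "components (V, E)"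
  assume N: "network (V, E)"
    and del: "\<forall>u v. {u, v} \<in> E - E' \<longrightarrow> (\<exists>c\<in>?P. \<exists>d\<in>?P. c \<noteq> d \<and> u \<in> c \<and> v \<in> d)"
    and add: "\<forall>u v. {u, v} \<in> E' - E \<longrightarrow> (\<exists>c\<in>?P. u \<in> c \<and> v \<in> c)"
  note P = partition_on_components[of "(V, E)"]
  \<comment> \<open>no edge joins two distinct components, so nothing can be deleted\<close>
  have "E \<subseteq> E'"
  proof
    fix e assume e: "e \<in> E"
    then obtain u v where uv: "e = {u, v}"
      using N by (auto simp: network_def card_2_iff)
    show "e \<in> E'"
    proof (rule ccontr)
      assume "e \<notin> E'"
      then obtain c d where "c \<in> ?P" "d \<in> ?P" "c \<noteq> d" "u \<in> c" "v \<in> d"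
        using del e uv by blast
      moreover have "v \<in> c"
        using component_closed_edge[OF N \<open>c \<in> ?P\<close>, of u v] e uv \<open>u \<in> c\<close> by simp
      ultimately show False using partition_on_same_block[OF P] by blast
    qed
  qed
  \<comment> \<open>Only additions remain: old paths survive, and every edge of \<open>E'\<close>,
    old or new, stays within one old component.\<close>
  show "components (V, E') = ?P"
  proof (rule components_eqI)
    show "partition_on (verts (V, E')) ?P" using P by simp
    show "reachable (V, E') u v" if "c \<in> ?P" "u \<in> c" "v \<in> c" for c u v
      using reachable_mono[OF reachable_in_component[OF that]] \<open>E \<subseteq> E'\<close> by simp
    show "\<exists>c\<in>?P. u \<in> c \<and> v \<in> c" if "{u, v} \<in> edges (V, E')" for u v
      using that add edge_within_component[OF N, of u v] by auto
  qed
qed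

lemma fixed_point_components: "fixed_point components"
  unfolding fixed_point_def
proof (intro allI impI, elim conjE)
  fix N :: "'a network" and D
  assume N: "network N" and D: "D \<subseteq> components N"
  let ?I = "induced N (\<Union>D)"
  note P = partition_on_components[of N]
  show "components ?I = D"
  proof (rule components_eqI)
    have "verts ?I = \<Union>D"
      using D partition_onD1[OF P] by (auto simp: induced_def)
    then show "partition_on (verts ?I) D"
      using P D unfolding partition_on_def by (auto intro: pairwise_subset)
    show "reachable ?I u v" if c: "c \<in> D" "u \<in> c" "v \<in> c" for c u v
    proof -
      have "reachable N u v"
        using reachable_in_component[OF subsetD[OF D c(1)] c(2,3)] .
      \<comment> \<open>A path of \<open>N\<close> starting in \<open>c\<close> is followed edge by
        edge. The invariant records both that it stays in \<open>c\<close> and that the part walked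
        so far exists in the induced subgraph; the former keeps its next edge there as well.\<close>
      then have "v \<in> {w \<in> c. reachable ?I u w}"
      proof (rule reachable_closed)
        show "u \<in> {w \<in> c. reachable ?I u w}" using c by simp
        fix x y assume xy: "{x, y} \<in> edges N" and x: "x \<in> {w \<in> c. reachable ?I u w}"
        then have y: "y \<in> c"
          using component_closed_edge[OF N subsetD[OF D c(1)] xy] by simp
        then have "{x, y} \<in> edges ?I"
          using xy x c(1) by (auto simp: induced_def)
        then show "y \<in> {w \<in> c. reachable ?I u w}"
          using x y by (auto intro: reachable_trans reachable_edge)
      qed
      then show ?thesis by simp
    qed
    show "\<exists>c\<in>D. u \<in> c \<and> v \<in> c" if "{u, v} \<in> edges ?I" for u v
    proof -
      have uv: "{u, v} \<in> edges N" "u \<in> \<Union>D" using that by (auto simp: induced_def)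
      then obtain c where "c \<in> D" "u \<in> c" by blast
      then show ?thesis using component_closed_edge[OF N _ uv(1)] D by blast
    qed
  qed
qed

section \<open>Pairs of cliques and the failing axioms: Connectivity, Pair-of-Cliques\<close>

lemma ex_pair_of_cliques_component:
  assumes "n \<ge> 1"
  shows "\<exists>(N :: 'a :: infinite network) A B. network N \<and> pair_of_cliques_component N A B n"
proof -
  \<comment> \<open>The class \<open>infinite\<close> supplies finite vertex sets of every size, so
    the cliques can be arbitrarily large.\<close>
  obtain V :: "'a set" where V: "finite V" "card V = 2 * n"
    using infinite_arbitrarily_large[OF infinite_UNIV] by blast
  then obtain A where A: "A \<subseteq> V" "card A = n"
    using obtain_subset_with_card_n[of n V] by auto
  define B where "B = V - A"
  have fin: "finite A" "finite B" using V A by (auto simp: B_def intro: finite_subset)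
  have B: "card B = n" using A V fin by (simp add: B_def card_Diff_subset)
  have AB: "A \<inter> B = {}" by (auto simp: B_def)
  obtain a b where a: "a \<in> A" and b: "b \<in> B"
    using A(2) B assms by (metis card.empty ex_in_conv not_one_le_zero)
  then have ab: "a \<noteq> b" using AB by blast
  define E where "E = insert {a, b} {e. card e = 2 \<and> (e \<subseteq> A \<or> e \<subseteq> B)}"
  let ?N = "(A \<union> B, E)"
  have cA: "clique ?N A" and cB: "clique ?N B"
    by (auto simp: clique_def E_def)
  have "network ?N"
    using fin a b ab by (auto simp: network_def E_def)
  moreover have "A \<union> B \<in> components ?N"
  proof -
    have "reachable ?N a v" if "v \<in> A" for v
      using cA a that by (cases "a = v") (auto simp: clique_def intro: reachable_edge)
    moreover have "reachable ?N b v" if "v \<in> B" for v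
      using cB b that by (cases "b = v") (auto simp: clique_def intro: reachable_edge)
    moreover have "reachable ?N a b"
      by (rule reachable_edge) (simp add: E_def)
    \<comment> \<open>From \<open>a\<close>, a vertex of \<open>B\<close> is reached by crossing the
      bridge to \<open>b\<close> and then staying in the second clique.\<close>
    ultimately have "{v \<in> verts ?N. reachable ?N a v} = A \<union> B"
      by (auto intro: reachable_trans)
    then show ?thesis using a unfolding components_def by force
  qed
  moreover have "{e \<in> E. e \<inter> A \<noteq> {} \<and> e \<inter> B \<noteq> {}} = {{a, b}}"
    using a b AB by (auto simp: E_def)
  ultimately show ?thesis
    using AB A(2) B cA cB unfolding pair_of_cliques_component_def
    by (intro exI[of _ ?N] exI[of _ A] exI[of _ B]) simp
qed

text \<open>The bridge is a cut of size 1: without it no edge leaves \<open>A\<close>, so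
  \<open>B\<close> cannot be reached from \<open>A\<close>. Both sides are nonempty because
  \<open>n \<ge> 1\<close>.\<close>

lemma min_edge_cut_pair_of_cliques_component:
  assumes N: "network N" and "pair_of_cliques_component N A B n" "n \<ge> 1"
  shows "min_edge_cut (induced N (A \<union> B)) \<le> 1"
proof -
  let ?I = "induced N (A \<union> B)"
  define F where "F = {e \<in> edges N. e \<inter> A \<noteq> {} \<and> e \<inter> B \<noteq> {}}"
  have AB: "A \<inter> B = {}" and sub: "A \<subseteq> verts N" "B \<subseteq> verts N" and F: "card F = 1"
    and card: "card A = n" "card B = n"
    using assms by (auto simp: pair_of_cliques_component_def clique_def F_def)
  obtain a b where a: "a \<in> A" and b: "b \<in> B"
    using card assms(3) by (metis card.empty ex_in_conv not_one_le_zero)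
  \<comment> \<open>A two-element edge meeting both of the disjoint sets has one endpoint in each,
    so it survives in the induced subgraph.\<close>
  have "F \<subseteq> edges ?I"
  proof
    fix e assume e: "e \<in> F"
    then have "card e = 2" using N by (auto simp: F_def network_def)
    then show "e \<in> edges ?I"
      using e AB by (auto simp: F_def induced_def card_2_iff)
  qed
  moreover have "\<not> connected_network (verts ?I, edges ?I - F)"
  proof
    assume "connected_network (verts ?I, edges ?I - F)"
    then have "reachable (verts ?I, edges ?I - F) a b"
      using a b sub by (auto simp: connected_network_def induced_def)
    \<comment> \<open>The invariant set is \<open>A\<close>: a remaining edge from \<open>A\<close>
      to \<open>B\<close> would belong to \<open>F\<close>.\<close>
    then have "b \<in> A"
      by (rule reachable_closed) (use a in \<open>auto simp: F_def induced_def\<close>)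
    then show False using b AB by blast
  qed
  ultimately show ?thesis
    unfolding min_edge_cut_def using F by (intro Least_le) blast
qed

lemma not_connectivity_components:
  "\<not> connectivity (components :: 'a :: infinite network \<Rightarrow> 'a set set)"
proof
  assume "connectivity (components :: 'a network \<Rightarrow> 'a set set)"
  then obtain f :: "real \<Rightarrow> real" where lim: "filterlim f at_top at_top"
    and cut: "\<And>(N :: 'a network) c. network N \<Longrightarrow> c \<in> components N \<Longrightarrow> card c \<ge> 2 \<Longrightarrow>
      f (real (card c)) < real (min_edge_cut (induced N c))"
    unfolding connectivity_def by blast
  \<comment> \<open>The threshold 1 suffices: the cut has size at most 1 and the axiom demands
    strictly more than \<open>f\<close>.\<close>
  from lim obtain x0 where x0: "\<And>x. x \<ge> x0 \<Longrightarrow> f x \<ge> 1"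
    unfolding filterlim_at_top eventually_at_top_linorder by blast
  obtain m :: nat where m: "x0 \<le> real m" using real_arch_simple by blast
  \<comment> \<open>The maximum with 1 makes the cliques nonempty, and the cluster size
    \<open>2 * n\<close> is at least \<open>m\<close>, hence beyond \<open>x0\<close>.\<close>
  define n where "n = max m 1"
  have n: "n \<ge> 1" by (simp add: n_def)
  then obtain N :: "'a network" and A B
    where N: "network N" and AB: "pair_of_cliques_component N A B n"
    using ex_pair_of_cliques_component by blast
  have card: "card (A \<union> B) = 2 * n"
    using AB n by (subst card_Un_disjoint)
      (auto simp: pair_of_cliques_component_def intro: card_ge_0_finite)
  have "f (real (card (A \<union> B))) < real (min_edge_cut (induced N (A \<union> B)))"
    using AB n card by (intro cut[OF N]) (auto simp: pair_of_cliques_component_def)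
  moreover have "f (real (card (A \<union> B))) \<ge> 1"
    using m card by (intro x0) (auto simp: n_def)
  ultimately show False
    using min_edge_cut_pair_of_cliques_component[OF N AB n] by linarith
qed

text \<open>Were \<open>A\<close> a component as well as \<open>A \<union> B\<close>, two distinct
  components would overlap.\<close>

lemma not_pair_of_cliques_components:
  "\<not> pair_of_cliques (components :: 'a :: infinite network \<Rightarrow> 'a set set)"
proof
  assume "pair_of_cliques (components :: 'a network \<Rightarrow> 'a set set)"
  then obtain n0 where n0: "\<And>(N :: 'a network) A B n. network N \<Longrightarrow>
      pair_of_cliques_component N A B n \<Longrightarrow> 2 * n \<ge> n0 \<Longrightarrow> A \<in> components N \<and> B \<in> components N"
    unfolding pair_of_cliques_def by blast
  \<comment> \<open>The clique size \<open>Suc n0\<close> exceeds the threshold and is positive even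
    if \<open>n0 = 0\<close>, so neither clique is empty.\<close>
  have "Suc n0 \<ge> 1" by simp
  then obtain N :: "'a network" and A B
    where N: "network N" and AB: "pair_of_cliques_component N A B (Suc n0)"
    using ex_pair_of_cliques_component by blast
  have "A \<in> components N" using n0[OF N AB] by simp
  moreover have "A \<union> B \<in> components N" "A \<inter> B = {}" "A \<noteq> {}" "B \<noteq> {}"
    using AB by (auto simp: pair_of_cliques_component_def)
  ultimately show False
    using partition_on_same_block[OF partition_on_components[of N], of A "A \<union> B"] by blast
qed

theorem theorem1:
  fixes CC :: "'a :: infinite network \<Rightarrow> 'a set set"
  defines "CC \<equiv> components_are_clusters"
  shows "clustering_method CC \<and> richness CC \<and> standard_consistency CC \<and> fixed_point CC \<and>
    \<not> connectivity CC \<and> \<not> pair_of_cliques CC"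
proof -
  have "CC = components"
    by (simp add: CC_def components_are_clusters_def fun_eq_iff)
  then show ?thesis
    by (simp add: clustering_method_def partition_on_components richness_components
        standard_consistency_components fixed_point_components not_connectivity_components
        not_pair_of_cliques_components)
qed

end
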